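(* For all integers $\Delta,g\geq 3$ there exists a $\Delta$-regular graph $G$ with girth at least $g$ that has frozen $(\Delta+1)$-colourings (i.e. at least one proper $(\Delta+1)$-colouring of $G$ is frozen).
   Context: All graphs are finite, simple and labeled. A (proper) $k$-colouring of $G$ is a function $\alpha:V(G)\to[k]$ with $\alpha(x)\neq\alpha(y)$ for every edge $xy$. For $G$ of maximum degree $\Delta$, a proper $(\Delta+1)$-colouring of $G$ is frozen if for every vertex $v$ all $\Delta+1$ colours appear in the closed neighbourhood $N[v]=N(v)\cup\{v\}$. The girth is the length of a shortest cycle. *)

theory Defs
  imports "Graph_Theory.Pair_Digraph" "HOL-Library.Extended_Nat" "HOL-Library.FuncSet"
begin

text \<open>
  Finite simple graphs are instances of the locale \<open>pair_graph\<close>: finite, symmetric,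
  loop-free digraphs without parallel arcs. An undirected edge \<open>uv\<close> is the pair of arcs
  \<open>(u, v)\<close> and \<open>(v, u)\<close>, so the degree of a vertex is its out-degree.
\<close>

definition regular :: "'a pair_pre_digraph \<Rightarrow> nat \<Rightarrow> bool" where
  "regular G d \<longleftrightarrow> (\<forall>v \<in> verts G. out_degree G v = d)"

text \<open>Only meaningful for graphs with a nonempty finite vertex set.\<close>

definition max_degree :: "'a pair_pre_digraph \<Rightarrow> nat" where
  "max_degree G = Max (out_degree G ` verts G)"

text \<open>
  In a symmetric digraph the predicate \<open>pre_digraph.cycle\<close> also holds for the walks \<open>u, v, u\<close>
  that traverse an edge back and forth. The closed walks of length at least 3 without repeated
  vertices are exactly the cycles of the undirected graph. An acyclic graph has girth \<open>\<infinity>\<close>.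
\<close>

definition girth :: "'a pair_pre_digraph \<Rightarrow> enat" where
  "girth G = (INF p \<in> {p. pre_digraph.cycle G p \<and> 3 \<le> length p}. enat (length p))"

definition closed_neighbourhood :: "'a pair_pre_digraph \<Rightarrow> 'a \<Rightarrow> 'a set" where
  "closed_neighbourhood G v = insert v {w. v \<rightarrow>\<^bsub>G\<^esub> w}"

definition proper_colouring :: "'a pair_pre_digraph \<Rightarrow> nat \<Rightarrow> ('a \<Rightarrow> nat) \<Rightarrow> bool" where
  "proper_colouring G k \<alpha> \<longleftrightarrow>
     \<alpha> \<in> verts G \<rightarrow> {1..k} \<and> (\<forall>x y. x \<rightarrow>\<^bsub>G\<^esub> y \<longrightarrow> \<alpha> x \<noteq> \<alpha> y)"

definition frozen :: "'a pair_pre_digraph \<Rightarrow> ('a \<Rightarrow> nat) \<Rightarrow> bool" where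
  "frozen G \<alpha> \<longleftrightarrow>
     proper_colouring G (max_degree G + 1) \<alpha> \<and>
     (\<forall>v \<in> verts G. \<alpha> ` closed_neighbourhood G v = {1..max_degree G + 1})"

end

theory Submission
  imports Defs "HOL-Combinatorics.Permutations"
begin

text \<open>
  The graph is a lift of the complete graph on the colours \<open>1, \<dots>, \<Delta> + 1\<close>; the projection
  to the colours is then a frozen colouring. The lift is governed by one involution for every
  edge of the complete graph, acting on the finite set of words in the edges, without equal
  neighbouring letters, of length at most \<open>g\<close>: the involution of \<open>e\<close> prepends \<open>e\<close>, or removes
  it if it is the first letter. A vertex is a colour together with a permutation of the words,
  and following an edge composes the permutation with the corresponding involution. The edges
  along a cycle of length at most \<open>g\<close> spell such a word, and the composition of their
  involutions carries the empty word to its reversal; so this composition is not the identity,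
  and the cycle cannot close up.
\<close>

definition reduced_words :: "'e set \<Rightarrow> nat \<Rightarrow> 'e list set" where
  "reduced_words L r = {w. set w \<subseteq> L \<and> length w \<le> r \<and> distinct_adj w}"

text \<open>Left multiplication by the generator \<open>e\<close> in the free product of copies of
  Z/2, one for each letter, cut off at length \<open>r\<close>. Words of length \<open>r\<close>
  that do not start with \<open>e\<close> are fixed, which keeps the finite set invariant and the
  map an involution. Lists outside the set are fixed too, as \<open>permutes\<close>
  demands.\<close>

definition toggle :: "'e set \<Rightarrow> nat \<Rightarrow> 'e \<Rightarrow> 'e list \<Rightarrow> 'e list" where
  "toggle L r e w =
     (if w \<notin> reduced_words L r then w
      else if w \<noteq> [] \<and> hd w = e then tl w
      else if length w < r then e # w
      else w)"

lemma finite_reduced_words: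
  assumes "finite L"
  shows "finite (reduced_words L r)"
  by (rule finite_subset[OF _ finite_lists_length_le[OF assms, of r]])
     (auto simp: reduced_words_def)

lemma toggle_in_reduced_words:
  assumes "e \<in> L" "w \<in> reduced_words L r"
  shows "toggle L r e w \<in> reduced_words L r"
  using assms by (cases w) (auto simp: toggle_def reduced_words_def distinct_adj_Cons)

lemma toggle_toggle:
  assumes "e \<in> L"
  shows "toggle L r e (toggle L r e w) = w"
proof (cases "w \<in> reduced_words L r")
  case True
  with toggle_in_reduced_words[OF assms True] show ?thesis
    by (cases w) (auto simp: toggle_def reduced_words_def distinct_adj_Cons)
qed (simp add: toggle_def)

lemma toggle_comp_toggle:
  assumes "e \<in> L"
  shows "toggle L r e \<circ> (toggle L r e \<circ> f) = f"
  by (simp add: fun_eq_iff toggle_toggle[OF assms])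

lemma toggle_permutes:
  assumes "e \<in> L"
  shows "toggle L r e permutes reduced_words L r"
proof (rule bij_imp_permutes)
  show "bij_betw (toggle L r e) (reduced_words L r) (reduced_words L r)"
    by (rule bij_betwI[where g = "toggle L r e"])
       (auto simp: toggle_in_reduced_words toggle_toggle assms)
qed (simp add: toggle_def)

text \<open>Every suffix of a reduced word is reduced, so each letter of \<open>es\<close> differs
  from the first letter of the word built so far and still has room: every \<open>toggle\<close>
  prepends and nothing cancels.\<close>

lemma fold_toggle:
  assumes "rev es @ w \<in> reduced_words L r"
  shows "fold (toggle L r) es w = rev es @ w"
  using assms
proof (induction es arbitrary: w)
  case (Cons e es)
  have w: "w \<in> reduced_words L r" "length w < r" "w \<noteq> [] \<longrightarrow> hd w \<noteq> e"
    using Cons.prems by (auto simp: reduced_words_def distinct_adj_append_iff distinct_adj_Cons)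
  then have "toggle L r e w = e # w"
    by (auto simp add: toggle_def)
  with Cons show ?case by simp
qed simp

lemma pcas_nth:
  assumes "pcas u p v" "Suc i < length p"
  shows "snd (p ! i) = fst (p ! Suc i)"
  using assms
proof (induction p arbitrary: u i)
  case (Cons e p)
  then show ?case by (cases i; cases p) auto
qed simp

lemma pcas_last:
  assumes "pcas u p v" "p \<noteq> []"
  shows "snd (last p) = v"
  using assms by (induction p arbitrary: u) (auto split: if_splits)

lemma tl_pawalk_verts:
  assumes "pcas u p v"
  shows "tl (pawalk_verts u p) = map snd p"
proof -
  have "pawalk_verts u p = u # map snd p"
    using assms by (induction p arbitrary: u) auto
  then show ?thesis by simp
qed

text \<open>\<open>fst (p ! i)\<close> is the head of the arc cyclically before
  \<open>p ! i\<close>. With at least 3 arcs, that arc is not \<open>p ! Suc i\<close>, and distinct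
  arcs of \<open>p\<close> have distinct heads.\<close>

lemma cycle_nth_no_return:
  assumes cas: "pcas u p u" and dist: "distinct (map snd p)" and len: "3 \<le> length p"
    and i: "Suc i < length p"
  shows "fst (p ! i) \<noteq> snd (p ! Suc i)"
proof -
  have inj: "snd (p ! j) \<noteq> snd (p ! k)" if "j < length p" "k < length p" "j \<noteq> k" for j k
    using dist that by (metis length_map nth_eq_iff_index_eq nth_map)
  show ?thesis
  proof (cases i)
    case 0
    have "fst (p ! 0) = u" using cas len by (cases p) auto
    also have "u = snd (p ! (length p - 1))"
      using pcas_last[OF cas] len by (cases "p = []") (auto simp: last_conv_nth)
    finally show ?thesis using inj[of "length p - 1" 1] len 0 by simp
  next
    case (Suc j)
    then show ?thesis using pcas_nth[OF cas, of j] inj[of j "Suc i"] i by simp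
  qed
qed

text \<open>
  The vertices are numbered by \<open>h\<close>, since the graph must have type \<open>nat pair_pre_digraph\<close>.
  The letter of the edge between the colours \<open>i\<close> and \<open>j\<close> is the set \<open>{i, j}\<close>; the other
  subsets of \<open>C\<close> are letters that no edge uses.
\<close>

locale toggle_lift =
  fixes C :: "nat set" and r :: nat and N :: nat
    and h :: "nat \<Rightarrow> nat \<times> (nat set list \<Rightarrow> nat set list)"
  assumes finite_C: "finite C"
    and bij_h: "bij_betw h {..<N} (C \<times> {\<sigma>. \<sigma> permutes reduced_words (Pow C) r})"
begin

abbreviation colour :: "nat \<Rightarrow> nat" where "colour v \<equiv> fst (h v)"
abbreviation perm :: "nat \<Rightarrow> nat set list \<Rightarrow> nat set list" where "perm v \<equiv> snd (h v)"
abbreviation tog :: "nat set \<Rightarrow> nat set list \<Rightarrow> nat set list" where "tog \<equiv> toggle (Pow C) r"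

definition lift_arc :: "nat \<Rightarrow> nat \<Rightarrow> bool" where
  "lift_arc x y \<longleftrightarrow> x < N \<and> y < N \<and> colour x \<noteq> colour y \<and>
     perm y = tog {colour x, colour y} \<circ> perm x"

definition lift_graph :: "nat pair_pre_digraph" where
  "lift_graph = \<lparr>pverts = {..<N}, parcs = {(x, y). lift_arc x y}\<rparr>"

lemma lift_graph_simps [simp]:
  "pverts lift_graph = {..<N}" "(x, y) \<in> parcs lift_graph \<longleftrightarrow> lift_arc x y"
  by (simp_all add: lift_graph_def)

lemma colour_in: "v < N \<Longrightarrow> colour v \<in> C"
  and perm_permutes: "v < N \<Longrightarrow> perm v permutes reduced_words (Pow C) r"
  using bij_betwE[OF bij_h] by (auto simp: mem_Times_iff)

lemma vertex_eqI:
  assumes "x < N" "y < N" "colour x = colour y" "perm x = perm y"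
  shows "x = y"
  using bij_betw_imp_inj_on[OF bij_h] assms by (auto simp: inj_on_def prod_eq_iff)

lemma vertex_ex:
  assumes "c \<in> C" "\<sigma> permutes reduced_words (Pow C) r"
  obtains v where "v < N" "colour v = c" "perm v = \<sigma>"
proof -
  have "(c, \<sigma>) \<in> h ` {..<N}"
    using assms bij_betw_imp_surj_on[OF bij_h] by simp
  then show ?thesis using that by (auto simp: prod_eq_iff)
qed

text \<open>Each toggle is an involution, so composing with it again leads back.\<close>

lemma lift_arc_sym: "lift_arc x y \<Longrightarrow> lift_arc y x"
  unfolding lift_arc_def
  using toggle_comp_toggle[of "{colour x, colour y}" "Pow C" r "perm x"]
  by (auto simp: colour_in insert_commute)

lemma pair_graph_lift: "pair_graph lift_graph"
proof
  show "symmetric lift_graph"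
    by (auto simp: symmetric_def sym_def lift_arc_sym)
  have "parcs lift_graph \<subseteq> {..<N} \<times> {..<N}"
    by (auto simp: lift_arc_def)
  then show "finite (parcs lift_graph)" by (rule finite_subset) simp
qed (auto simp: lift_arc_def)

text \<open>The projection to the complete graph is a covering: the colour of a neighbour determines
  the letter, hence the permutation and the vertex. Every other colour occurs because all
  permutations are available as second components. Regularity and frozenness both rest on
  this.\<close>

lemma neighbour_colours:
  assumes "v < N"
  shows "bij_betw colour {w. lift_arc v w} (C - {colour v})"
proof (rule bij_betw_imageI)
  show "inj_on colour {w. lift_arc v w}"
    by (rule inj_onI, rule vertex_eqI) (auto simp: lift_arc_def)
  show "colour ` {w. lift_arc v w} = C - {colour v}"
  proof (intro equalityI subsetI)
    fix c assume c: "c \<in> C - {colour v}"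
    have "tog {colour v, c} \<circ> perm v permutes reduced_words (Pow C) r"
      using c assms by (intro permutes_compose perm_permutes toggle_permutes)
                       (auto simp: colour_in)
    then obtain w where "w < N" "colour w = c" "perm w = tog {colour v, c} \<circ> perm v"
      using vertex_ex c by blast
    then show "c \<in> colour ` {w. lift_arc v w}"
      using c assms by (auto simp: lift_arc_def)
  qed (auto simp: lift_arc_def colour_in)
qed

lemma out_degree_lift:
  assumes "v < N"
  shows "out_degree lift_graph v = card C - 1"
proof -
  have "out_arcs lift_graph v = Pair v ` {w. lift_arc v w}"
    by (auto simp: out_arcs_def)
  then have "out_degree lift_graph v = card {w. lift_arc v w}"
    by (simp add: out_degree_def card_image inj_on_def)
  also have "\<dots> = card (C - {colour v})"
    using neighbour_colours[OF assms] by (rule bij_betw_same_card)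
  finally show ?thesis using assms finite_C by (simp add: colour_in)
qed

lemma colour_closed_neighbourhood:
  assumes "v < N"
  shows "colour ` closed_neighbourhood lift_graph v = C"
  using bij_betw_imp_surj_on[OF neighbour_colours[OF assms]] colour_in[OF assms]
  by (auto simp: closed_neighbourhood_def)

lemma perm_along_walk:
  assumes "pcas u p v" "set p \<subseteq> parcs lift_graph"
  shows "perm v z = fold tog (map (\<lambda>(x, y). {colour x, colour y}) p) (perm u z)"
  using assms by (induction p arbitrary: u) (auto simp: lift_arc_def)

lemma no_short_cycle:
  assumes cyc: "pre_digraph.cycle lift_graph p" and len: "3 \<le> length p"
  shows "r < length p"
proof (rule ccontr)
  assume "\<not> r < length p"
  let ?ws = "map (\<lambda>(x, y). {colour x, colour y}) p"
  obtain u where u: "u < N" and arcs: "set p \<subseteq> parcs lift_graph" and cas: "pcas u p u"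
    and dist: "distinct (map snd p)"
    using cyc by (auto simp: pre_digraph.cycle_def pre_digraph.awalk_def cas_with_proj_eq
        awalk_verts_with_proj_eq tl_pawalk_verts)
  have "distinct_adj ?ws"
    unfolding distinct_adj_conv_nth
  proof (intro allI impI)
    fix i assume "Suc i < length ?ws"
    then have i: "Suc i < length p" by simp
    obtain x y z where xy: "p ! i = (x, y)" "p ! Suc i = (y, z)"
      using pcas_nth[OF cas i] by (metis prod.collapse)
    have "lift_arc x y" "lift_arc y z"
      using arcs i xy nth_mem[of i p] nth_mem[of "Suc i" p] by auto
    moreover have "x \<noteq> z"
      using cycle_nth_no_return[OF cas dist len i] xy by simp
    \<comment> \<open>If the letters agreed, then \<open>colour x = colour z\<close>, and
      \<open>perm x\<close> and \<open>perm z\<close> would both be the same toggle composed with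
      \<open>perm y\<close>, so \<open>x = z\<close>.\<close>
    ultimately have "{colour x, colour y} \<noteq> {colour y, colour z}"
      using lift_arc_sym[of x y] vertex_eqI[of x z]
      by (auto simp: lift_arc_def doubleton_eq_iff insert_commute)
    then show "?ws ! i \<noteq> ?ws ! Suc i" using i xy by simp
  qed
  moreover have "set ?ws \<subseteq> Pow C"
    using arcs by (auto simp: lift_arc_def colour_in)
  ultimately have red: "rev ?ws @ [] \<in> reduced_words (Pow C) r"
    using \<open>\<not> r < length p\<close> by (simp add: reduced_words_def)
  \<comment> \<open>Surjectivity of \<open>perm u\<close> gives a preimage of the empty word. Going
    around the cycle must return this empty word, while the toggles turn it into
    \<open>rev ?ws\<close>.\<close>
  obtain z where z: "perm u z = []"
    using perm_permutes[OF u] by (metis permutes_surj surjD)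
  have "rev ?ws = []"
    using perm_along_walk[OF cas arcs, of z] fold_toggle[OF red] z by simp
  with len show False by auto
qed

end

theorem proposition5:
  fixes \<Delta> g :: nat
  assumes "\<Delta> \<ge> 3" and "g \<ge> 3"
  shows "\<exists>G :: nat pair_pre_digraph.
           pair_graph G \<and> verts G \<noteq> {} \<and> regular G \<Delta> \<and> girth G \<ge> enat g \<and>
           (\<exists>\<alpha>. proper_colouring G (\<Delta> + 1) \<alpha> \<and> frozen G \<alpha>)"
proof -
  define C where "C = {1..\<Delta> + 1}"
  let ?V = "C \<times> {\<sigma>. \<sigma> permutes reduced_words (Pow C) g}"
  have "finite ?V"
    by (intro finite_cartesian_product finite_permutations finite_reduced_words) (simp_all add: C_def)
  then obtain N :: nat and h where h: "bij_betw h {..<N} ?V"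
    using ex_bij_betw_nat_finite[of ?V] by (auto simp: atLeast0LessThan)
  interpret toggle_lift C g N h
    by unfold_locales (simp add: C_def, rule h)
  \<comment> \<open>The identity permutation supplies a vertex; it also makes the \<open>Max\<close>
    in \<open>max_degree\<close> one over a nonempty set.\<close>
  obtain v where v: "v < N"
    by (rule vertex_ex[of 1 id]) (auto simp: C_def permutes_id)
  have deg: "out_degree lift_graph w = \<Delta>" if "w < N" for w
    using out_degree_lift[OF that] by (simp add: C_def)
  then have "out_degree lift_graph ` {..<N} = {\<Delta>}"
    using v by (auto simp: image_iff intro!: bexI[of _ v])
  then have max: "max_degree lift_graph = \<Delta>"
    by (simp add: max_degree_def)
  \<comment> \<open>With \<open>g\<close> as the bound on word length, every cycle has more than
    \<open>g\<close> arcs.\<close>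
  have "enat g \<le> girth lift_graph"
    unfolding girth_def by (rule INF_greatest) (auto dest: no_short_cycle)
  moreover have proper: "proper_colouring lift_graph (\<Delta> + 1) colour"
    unfolding proper_colouring_def C_def[symmetric]
    using colour_in by (auto simp: lift_arc_def)
  moreover have "frozen lift_graph colour"
    unfolding frozen_def max C_def[symmetric]
    using proper colour_closed_neighbourhood by simp
  moreover have "regular lift_graph \<Delta>"
    using deg by (simp add: regular_def)
  ultimately show ?thesis
    using pair_graph_lift v by (intro exI[of _ lift_graph]) auto
qed

end
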